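(* Let $E$ be a separable Banach lattice, and let $f_j \colon \mathrm{SB}(E) \to E$, $j \in \omega$, be continuous functions such that for every $F \in \mathrm{SB}(E)$ one has $f_j(F) \in F$ for all $j\in\omega$ and $F = \overline{\{f_j(F) \colon j \in \omega\}}$. Then a closed subspace $F \in \mathrm{SB}(E)$ is a sublattice of $E$ if and only if $\lvert f_j(F) \rvert \in F$ for all $j \in \omega$. Moreover, the set $\mathrm{Subl}(E)$ of closed sublattices of $E$ is a closed ($\boldsymbol{\Pi}^0_1$) subset of $\mathrm{SB}(E)$ and hence a Polish space.
   Context: All Banach spaces are real. For a Polish space $X$, $\mathcal{F}(X)$ denotes the family of non-empty closed subsets of $X$, and for $U\subseteq X$ open, $E^+(U)=\{F\in\mathcal F(X)\colon F\cap U\neq\emptyset\}$. A topology $\tau$ on $\mathcal{F}(X)$ is admissible if $(\mathcal F(X),\tau)$ is Polish and: (A1) $E^+(U)$ is $\tau$-open for every open $U\subseteq X$; (A2) there is a $\tau$-subbase each element of which is a countable union of sets of the form $E^+(U)\setminus E^+(V)$ with $U,V\subseteq X$ open. Condition (A3) says that $\{(x,F)\in X\times\mathcal F(X)\colon x\in F\}$ is closed in the product topology. For a separable Banach space $X$, $\mathrm{SB}(X)\subseteq\mathcal F(X)$ is the set of all closed linear subspaces of $X$ with the subspace topology, where $\mathcal{F}(X)$ carries an admissible topology satisfying (A1)--(A3). An example is the Wijsman topology, i.e. the coarsest topology making $F\mapsto d(x,F)$ continuous for all $x\in X$, where $d$ is a compatible metric on $X$. It is known (Godefroy--Saint-Raymond)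 that $\mathrm{SB}(X)$ is a $\boldsymbol{\Pi}^0_2$ subset of $\mathcal F(X)$, hence Polish, and that functions $f_j$ as in the statement exist. For a Banach lattice $E$, $\lvert x\rvert = x\vee(-x)$. A closed linear subspace $F\subseteq E$ is a sublattice if $\lvert y\rvert\in F$ for every $y\in F$. $\mathrm{Subl}(E)\subseteq\mathrm{SB}(E)$ is the set of all closed sublattices of $E$. *)

theory Defs
  imports "HOL-Analysis.Analysis" "HOL-Library.Lattice_Algebras"
begin

text \<open>The parent class \<^class>\<open>lattice_ab_group_add_abs\<close> supplies \<open>\<bar>x\<bar> = sup x (- x)\<close>.\<close>

class banach_lattice = banach + ordered_real_vector + lattice_ab_group_add_abs +
  assumes norm_mono_abs: "\<bar>x\<bar> \<le> \<bar>y\<bar> \<Longrightarrow> norm x \<le> norm y"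

definition Polish_space :: "'a topology \<Rightarrow> bool" where
  "Polish_space T \<longleftrightarrow> separable_space T \<and> completely_metrizable_space T"

definition hyperspace :: "'a::topological_space set set" where
  "hyperspace = {F. closed F \<and> F \<noteq> {}}"

definition hit :: "'a::topological_space set \<Rightarrow> 'a set set" where
  "hit U = {F \<in> hyperspace. F \<inter> U \<noteq> {}}"

text \<open>The sets \<open>E\<^sup>+(U)\<close> are \<^term>\<open>hit U\<close>. In the subbase condition the empty intersection is
  the whole hyperspace, so the subbase itself need not cover.\<close>

definition admissible :: "'a::topological_space set topology \<Rightarrow> bool" where
  "admissible \<tau> \<longleftrightarrow>
     topspace \<tau> = hyperspace \<and>
     Polish_space \<tau> \<and>
     (\<forall>U. open U \<longrightarrow> openin \<tau> (hit U)) \<and>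
     (\<exists>\<S>. (\<forall>W\<in>\<S>. \<exists>\<C>. countable \<C> \<and> \<C> \<subseteq> {hit U - hit V | U V. open U \<and> open V} \<and> W = \<Union>\<C>) \<and>
          \<tau> = topology (arbitrary union_of
                (finite intersection_of (\<lambda>W. W \<in> \<S>) relative_to hyperspace)))"

definition closed_membership :: "'a::topological_space set topology \<Rightarrow> bool" where
  "closed_membership \<tau> \<longleftrightarrow>
     closedin (prod_topology euclidean \<tau>) {(x, F). F \<in> hyperspace \<and> x \<in> F}"

definition SB :: "'a::real_normed_vector set set" where
  "SB = {F. closed F \<and> subspace F}"

definition sublattice :: "'a::banach_lattice set \<Rightarrow> bool" where
  "sublattice F \<longleftrightarrow> F \<in> SB \<and> (\<forall>y\<in>F. \<bar>y\<bar> \<in> F)"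

definition Subl :: "'a::banach_lattice set set" where
  "Subl = {F \<in> SB. sublattice F}"

end

theory Submission
  imports Defs
begin

text \<open>
  The norm of a Banach lattice is monotone in the absolute value, so
  \<open>\<bar>\<bar>x\<bar> - \<bar>y\<bar>\<bar> \<le> \<bar>x - y\<bar>\<close> makes \<open>x \<mapsto> \<bar>x\<bar>\<close> continuous
  (\<open>continuous_on_abs_banach_lattice\<close>). It therefore suffices to test the sublattice condition
  on a dense subset of the closed set \<open>F\<close>, such as \<open>{f j F | j}\<close>.
  Hence \<open>Subl\<close> is the intersection over \<open>j\<close> of the sets \<open>{F \<in> SB. \<bar>f j F\<bar> \<in> F}\<close>. Each of them
  is the preimage of the closed membership relation under the continuous map
  \<open>F \<mapsto> (\<bar>f j F\<bar>, F)\<close>, so \<open>Subl\<close> is closed in \<open>SB\<close>.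

  Complete metrizability passes from the hyperspace to its \<open>G\<^sub>\<delta>\<close> subsets and from these to their
  closed subsets, so \<open>Subl\<close> is completely metrizable once \<open>SB\<close> is a \<open>G\<^sub>\<delta>\<close>
  (\<open>gdelta_in_SB\<close>). A nonempty closed set is a subspace iff it is closed under
  \<open>(x, y) \<mapsto> q x + y\<close> for every rational \<open>q\<close>, so it suffices that being closed under one
  continuous binary operation is a \<open>G\<^sub>\<delta>\<close> condition (\<open>gdelta_in_closed_under\<close>). With a
  countable base this condition splits into countably many implications of the form ``if \<open>F\<close>
  hits \<open>U\<close> and \<open>V\<close>, then \<open>F\<close> hits \<open>W\<close>''. As the sets \<open>hit U\<close> are open, each implication
  defines a union of two closed sets and an open set, which is a \<open>G\<^sub>\<delta>\<close> in a metrizable space.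

  Separability alone is not inherited by subspaces; for metrizable spaces it gives second
  countability, which is.
\<close>

lemma second_countable_if_separable_metrizable:
  assumes "metrizable_space X" and "separable_space X"
  shows "second_countable X"
proof -
  obtain M d where "Metric_space M d" and X: "X = Metric_space.mtopology M d"
    using assms(1) unfolding metrizable_space_def by blast
  then interpret Metric_space M d by simp
  obtain C where "countable C" "C \<subseteq> M" and dense: "mtopology closure_of C = M"
    using assms(2) unfolding separable_space_def X by auto
  define \<B> where "\<B> = (\<lambda>(c, n). mball c (inverse (real (Suc n)))) ` (C \<times> UNIV)"
  have "countable \<B>"
    unfolding \<B>_def using \<open>countable C\<close> by blast
  moreover have "\<forall>V\<in>\<B>. openin mtopology V"
    unfolding \<B>_def by auto
  moreover have "\<exists>V\<in>\<B>. x \<in> V \<and> V \<subseteq> U" if U: "openin mtopology U" "x \<in> U" for U x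
  proof -
    obtain r where r: "r > 0" "mball x r \<subseteq> U" and "x \<in> M"
      using U unfolding openin_mtopology by blast
    \<comment> \<open>Half the radius, so that a ball through \<open>x\<close> around a nearby centre stays in \<open>mball x r\<close>.\<close>
    obtain n where n: "inverse (real (Suc n)) < r / 2"
      using reals_Archimedean[of "r / 2"] r by auto
    have "\<forall>r>0. \<exists>c\<in>C. c \<in> mball x r"
      using dense \<open>x \<in> M\<close> unfolding metric_closure_of by blast
    then obtain c where c: "c \<in> C" "c \<in> mball x (inverse (real (Suc n)))"
      by (meson inverse_positive_iff_positive of_nat_0_less_iff zero_less_Suc)
    have "mball c (inverse (real (Suc n))) \<subseteq> mball x r"
      using c n by (intro mball_subset) (auto simp: commute)
    moreover have "x \<in> mball c (inverse (real (Suc n)))"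
      using c by (auto simp: commute)
    ultimately show ?thesis
      using r c(1) unfolding \<B>_def by blast
  qed
  ultimately show ?thesis
    unfolding second_countable_def X by blast
qed

text \<open>
  For basic open \<open>U\<close>, \<open>V\<close>, \<open>W\<close> with \<open>g(U \<times> V) \<subseteq> W\<close>, a set closed under \<open>g\<close> that hits \<open>U\<close> and
  \<open>V\<close> hits \<open>W\<close>. Conversely these implications put points of \<open>F\<close> into arbitrarily small
  neighbourhoods \<open>W\<close> of \<open>g x y\<close>, because continuity provides \<open>U\<close> and \<open>V\<close>; as \<open>F\<close> is closed,
  this gives \<open>g x y \<in> F\<close>.
\<close>

lemma gdelta_in_closed_under:
  fixes \<tau> :: "'a::topological_space set topology" and g :: "'a \<Rightarrow> 'a \<Rightarrow> 'a"
  assumes sc: "second_countable (euclidean :: 'a topology)"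
    and top: "topspace \<tau> = hyperspace"
    and metr: "metrizable_space \<tau>"
    and hit_open: "\<And>U. open U \<Longrightarrow> openin \<tau> (hit U)"
    and cont: "continuous_on UNIV (\<lambda>(x, y). g x y)"
  shows "gdelta_in \<tau> {F \<in> hyperspace. \<forall>x\<in>F. \<forall>y\<in>F. g x y \<in> F}"
proof -
  obtain \<B> :: "'a set set" where "countable \<B>" and op: "\<And>V. V \<in> \<B> \<Longrightarrow> open V"
    and base: "\<And>U x. open U \<Longrightarrow> x \<in> U \<Longrightarrow> \<exists>V\<in>\<B>. x \<in> V \<and> V \<subseteq> U"
    using sc unfolding second_countable_def by auto
  define I where "I = {(U, V, W) \<in> \<B> \<times> \<B> \<times> \<B>. \<forall>x\<in>U. \<forall>y\<in>V. g x y \<in> W}"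
  define G where "G = (\<lambda>(U :: 'a set, V :: 'a set, W :: 'a set).
    (hyperspace - hit U) \<union> (hyperspace - hit V) \<union> hit W)"
  have "countable I"
    by (rule countable_subset[of _ "\<B> \<times> \<B> \<times> \<B>"]) (auto simp: I_def \<open>countable \<B>\<close>)
  have "gdelta_in \<tau> (G i)" if "i \<in> I" for i
  proof -
    obtain U V W where i: "i = (U, V, W)" and "open U" "open V" "open W"
      using \<open>i \<in> I\<close> op unfolding I_def by auto
    have "gdelta_in \<tau> (hyperspace - hit A)" if "open A" for A
      using closed_imp_gdelta_in[OF metr] hit_open[OF that] top
      by (metis closedin_diff closedin_topspace)
    then show ?thesis
      using \<open>open U\<close> \<open>open V\<close> \<open>open W\<close> hit_open unfolding i G_def
      by (simp add: gdelta_in_Un open_imp_gdelta_in)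
  qed
  \<comment> \<open>Inserting the whole space keeps the intersection inside the hyperspace when \<open>I\<close> is empty.\<close>
  then have "gdelta_in \<tau> (\<Inter> (insert hyperspace (G ` I)))"
    using \<open>countable I\<close> gdelta_in_topspace[of \<tau>] unfolding top
    by (intro gdelta_in_Inter) auto
  moreover have "\<Inter> (insert hyperspace (G ` I)) = {F \<in> hyperspace. \<forall>x\<in>F. \<forall>y\<in>F. g x y \<in> F}"
  proof (intro equalityI subsetI)
    fix F assume F: "F \<in> \<Inter> (insert hyperspace (G ` I))"
    then have "F \<in> hyperspace" by blast
    have "g x y \<in> F" if "x \<in> F" "y \<in> F" for x y
    proof (rule ccontr)
      assume "g x y \<notin> F"
      then obtain W where W: "W \<in> \<B>" "g x y \<in> W" "W \<subseteq> - F"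
        using base[of "- F" "g x y"] \<open>F \<in> hyperspace\<close> unfolding hyperspace_def by auto
      have "open ((\<lambda>(x, y). g x y) -` W)"
        using cont op[OF W(1)] by (simp add: open_vimage)
      moreover have "(x, y) \<in> (\<lambda>(x, y). g x y) -` W"
        using W(2) by simp
      ultimately obtain A B where "open A" "open B" "x \<in> A" "y \<in> B"
        and AB: "A \<times> B \<subseteq> (\<lambda>(x, y). g x y) -` W"
        by (rule open_prod_elim) blast
      obtain U V where U: "U \<in> \<B>" "x \<in> U" "U \<subseteq> A" and V: "V \<in> \<B>" "y \<in> V" "V \<subseteq> B"
        using base[OF \<open>open A\<close> \<open>x \<in> A\<close>] base[OF \<open>open B\<close> \<open>y \<in> B\<close>] by blast
      have "g a b \<in> W" if "a \<in> U" "b \<in> V" for a b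
        using AB subsetD[OF U(3) that(1)] subsetD[OF V(3) that(2)] by auto
      then have "(U, V, W) \<in> I"
        using U(1) V(1) W(1) unfolding I_def by simp
      then have "F \<in> G (U, V, W)"
        using F by blast
      then show False
        using \<open>F \<in> hyperspace\<close> U(2) V(2) W(3) that unfolding G_def hit_def by blast
    qed
    then show "F \<in> {F \<in> hyperspace. \<forall>x\<in>F. \<forall>y\<in>F. g x y \<in> F}"
      using \<open>F \<in> hyperspace\<close> by blast
  next
    fix F assume F: "F \<in> {F \<in> hyperspace. \<forall>x\<in>F. \<forall>y\<in>F. g x y \<in> F}"
    have "F \<in> G (U, V, W)" if "(U, V, W) \<in> I" for U V W
      using F that unfolding G_def I_def hit_def by blast
    then show "F \<in> \<Inter> (insert hyperspace (G ` I))"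
      using F by auto
  qed
  ultimately show ?thesis by simp
qed

text \<open>
  Rational scalars suffice because \<open>F\<close> is closed and \<open>r \<mapsto> r x + y\<close> is continuous; \<open>0 \<in> F\<close> comes
  for free from \<open>q = -1\<close> and \<open>x = y\<close>, as \<open>F\<close> is nonempty.
\<close>

lemma SB_eq_rational_combinations:
  "(SB :: 'a::real_normed_vector set set) =
    (\<Inter>q\<in>\<rat>. {F \<in> hyperspace. \<forall>x\<in>F. \<forall>y\<in>F. q *\<^sub>R x + y \<in> F})"
proof (intro equalityI subsetI)
  fix F :: "'a set" assume "F \<in> SB"
  then show "F \<in> (\<Inter>q\<in>\<rat>. {F \<in> hyperspace. \<forall>x\<in>F. \<forall>y\<in>F. q *\<^sub>R x + y \<in> F})"
    unfolding SB_def hyperspace_def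
    by (auto simp: subspace_add subspace_scale dest: subspace_0)
next
  fix F :: "'a set" assume F: "F \<in> (\<Inter>q\<in>\<rat>. {F \<in> hyperspace. \<forall>x\<in>F. \<forall>y\<in>F. q *\<^sub>R x + y \<in> F})"
  then have "F \<in> hyperspace"
    using Rats_0 by blast
  then have "closed F" "F \<noteq> {}"
    unfolding hyperspace_def by auto
  have comb: "r *\<^sub>R x + y \<in> F" if "x \<in> F" "y \<in> F" for r x y
  proof -
    have "(\<lambda>r. r *\<^sub>R x + y) ` closure \<rat> \<subseteq> F"
      using F that \<open>closed F\<close> by (intro image_closure_subset) (auto intro!: continuous_intros)
    then show ?thesis
      by (auto simp: Rats_closure_real)
  qed
  have zero: "0 \<in> F"
    using comb[of _ _ "-1"] \<open>F \<noteq> {}\<close> by force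
  have "subspace F"
    unfolding subspace_def using zero comb[of _ _ 1] comb[OF _ zero] by auto
  then show "F \<in> SB"
    using \<open>closed F\<close> unfolding SB_def by blast
qed

lemma gdelta_in_SB:
  fixes \<tau> :: "'a::real_normed_vector set topology"
  assumes sep: "separable_space (euclidean :: 'a topology)"
    and top: "topspace \<tau> = hyperspace"
    and metr: "metrizable_space \<tau>"
    and hit_open: "\<And>U. open U \<Longrightarrow> openin \<tau> (hit U)"
  shows "gdelta_in \<tau> SB"
proof -
  have sc: "second_countable (euclidean :: 'a topology)"
    using metrizable_space_euclidean sep by (rule second_countable_if_separable_metrizable)
  have "gdelta_in \<tau> {F \<in> hyperspace. \<forall>x\<in>F. \<forall>y\<in>F. q *\<^sub>R x + y \<in> F}" for q
    by (rule gdelta_in_closed_under[OF sc top metr hit_open])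
      (simp_all add: case_prod_unfold continuous_intros)
  then show ?thesis
    unfolding SB_eq_rational_combinations
    by (intro gdelta_in_Inter) (auto simp: countable_rat)
qed

lemma continuous_on_abs_banach_lattice:
  "continuous_on S (abs :: 'a::banach_lattice \<Rightarrow> 'a)"
proof -
  have "dist \<bar>x\<bar> \<bar>y\<bar> \<le> dist x y" for x y :: 'a
    unfolding dist_norm by (intro norm_mono_abs abs_triangle_ineq3)
  then show ?thesis
    unfolding continuous_on_iff by (meson le_less_trans)
qed

theorem proposition4p3:
  fixes \<tau> :: "'a::banach_lattice set topology"
    and f :: "nat \<Rightarrow> 'a set \<Rightarrow> 'a"
  assumes "separable_space (euclidean :: 'a topology)"
    and "admissible \<tau>"
    and "closed_membership \<tau>"
    and "\<And>j. continuous_map (subtopology \<tau> SB) euclidean (f j)"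
    and "\<And>F j. F \<in> SB \<Longrightarrow> f j F \<in> F"
    and "\<And>F. F \<in> SB \<Longrightarrow> F = closure {f j F | j. True}"
  shows "(\<forall>F\<in>SB. sublattice F \<longleftrightarrow> (\<forall>j. \<bar>f j F\<bar> \<in> F)) \<and>
         closedin (subtopology \<tau> SB) Subl \<and>
         Polish_space (subtopology \<tau> Subl)"
proof -
  have top: "topspace \<tau> = hyperspace" and "separable_space \<tau>"
    and compl: "completely_metrizable_space \<tau>" and hit_open: "\<And>U. open U \<Longrightarrow> openin \<tau> (hit U)"
    using assms(2) unfolding admissible_def Polish_space_def by auto
  then have metr: "metrizable_space \<tau>"
    using completely_metrizable_imp_metrizable_space by blast
  have SB_sub: "SB \<subseteq> (hyperspace :: 'a set set)"
    unfolding SB_def hyperspace_def using subspace_0 by blast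

  have test: "sublattice F \<longleftrightarrow> (\<forall>j. \<bar>f j F\<bar> \<in> F)" if "F \<in> SB" for F
  proof
    assume "\<forall>j. \<bar>f j F\<bar> \<in> F"
    then have "abs ` closure {f j F | j. True} \<subseteq> F"
      using that continuous_on_abs_banach_lattice
      by (intro image_closure_subset) (auto simp: SB_def)
    then show "sublattice F"
      using that assms(6)[OF that] unfolding sublattice_def by blast
  qed (use assms(5) that in \<open>auto simp: sublattice_def\<close>)

  have closed_j: "closedin (subtopology \<tau> SB) {F \<in> SB. \<bar>f j F\<bar> \<in> F}" for j
  proof -
    have "continuous_map (subtopology \<tau> SB) euclidean (\<lambda>F. \<bar>f j F\<bar>)"
      using continuous_map_compose[OF assms(4)[of j], of euclidean abs]
        continuous_on_abs_banach_lattice[of UNIV] by (simp add: o_def)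
    then have "continuous_map (subtopology \<tau> SB) (prod_topology euclidean \<tau>) (\<lambda>F. (\<bar>f j F\<bar>, F))"
      by (intro continuous_map_pairedI) auto
    then have "closedin (subtopology \<tau> SB)
        {F \<in> topspace (subtopology \<tau> SB). (\<bar>f j F\<bar>, F) \<in> {(x, F). F \<in> hyperspace \<and> x \<in> F}}"
      using assms(3) unfolding closed_membership_def by (rule closedin_continuous_map_preimage)
    moreover have "{F \<in> topspace (subtopology \<tau> SB).
        (\<bar>f j F\<bar>, F) \<in> {(x, F). F \<in> hyperspace \<and> x \<in> F}} = {F \<in> SB. \<bar>f j F\<bar> \<in> F}"
      using SB_sub top by auto
    ultimately show ?thesis by simp
  qed
  have "Subl = (\<Inter>j. {F \<in> SB. \<bar>f j F\<bar> \<in> F})"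
    using test unfolding Subl_def by auto
  then have closed: "closedin (subtopology \<tau> SB) Subl"
    using closedin_INT[OF UNIV_not_empty closed_j] by (rule ssubst)

  have "completely_metrizable_space (subtopology \<tau> SB)"
    using compl gdelta_in_SB[OF assms(1) top metr hit_open]
    by (rule completely_metrizable_space_gdelta_in)
  then have "completely_metrizable_space (subtopology (subtopology \<tau> SB) Subl)"
    using closed by (rule completely_metrizable_space_closedin)
  moreover have "subtopology (subtopology \<tau> SB) Subl = subtopology \<tau> Subl"
    by (simp add: subtopology_subtopology Subl_def Int_absorb1)
  moreover have "separable_space (subtopology \<tau> Subl)"
    using second_countable_if_separable_metrizable[OF metr \<open>separable_space \<tau>\<close>]
    by (intro second_countable_imp_separable_space second_countable_subtopology)
  ultimately have "Polish_space (subtopology \<tau> Subl)"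
    unfolding Polish_space_def by simp
  with test closed show ?thesis by blast
qed

end
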